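(* For $n \ge 1$ let $\mathfrak{D}_n := \operatorname{denom}(B_n(x))$. Then: (i) if $n = 1$, $\mathfrak{D}_n = 2$; (ii) if $n \ge 3$ is odd, $\displaystyle \mathfrak{D}_n = \prod_{\substack{p \le \frac{n+1}{2} \\ s_p(n) \ge p}} p$; (iii) if $n \ge 2$ is even, $\displaystyle \mathfrak{D}_n = \prod_{(p-1) \mid n} p \;\times \prod_{\substack{(p-1) \nmid n \\ p \le \frac{n+1}{3} \\ s_p(n) \ge p}} p$, where all products run over primes $p$. In particular, $\mathfrak{D}_n$ is even and squarefree for all $n \ge 1$, and the sequence $(\mathfrak{D}_n)_{n \ge 1}$ is unbounded. Moreover, $\operatorname{denom}(B_n) \mid \operatorname{denom}(B_n(x))$ for all $n \ge 1$.
   Context: The Bernoulli numbers $B_k$ are defined by $\frac{t}{e^t-1} = \sum_{k\ge 0} B_k \frac{t^k}{k!}$ ($|t|<2\pi$), and the Bernoulli polynomials by $B_n(x) = \sum_{k=0}^n \binom{n}{k} B_k x^{n-k}$. For a rational number $\rho=\nu/\delta$ in lowest terms ($\nu\in\mathbb{Z}$, $\delta\in\mathbb{N}$), $\operatorname{denom}(\rho) := \delta$; for a polynomial $f(x) \in \mathbb{Q}[x]$, $\operatorname{denom}(f(x))$ is the smallest positive integer $d$ with $d\, f(x) \in \mathbb{Z}[x]$. For a prime $p$ and integer $x\ge0$ with base-$p$ digits $\alpha_0,\dots,\alpha_r$ (i.e. $x=\sum \alpha_j p^j$, $0\le\alpha_j\le p-1$), $s_p(x) := \sum_j \alpha_j$.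 *)

theory Defs
  imports "HOL-Complex_Analysis.Complex_Analysis" "HOL-Computational_Algebra.Computational_Algebra"
begin

definition bernoulli :: "nat \<Rightarrow> rat" where
  "bernoulli k = fact k * fps_nth (fps_X / (fps_exp 1 - 1)) k"

definition bernpoly :: "nat \<Rightarrow> rat poly" where
  "bernpoly n = (\<Sum>k\<le>n. monom (of_nat (n choose k) * bernoulli k) (n - k))"

definition rat_denom :: "rat \<Rightarrow> nat" where
  "rat_denom r = nat (snd (quotient_of r))"

definition poly_denom :: "rat poly \<Rightarrow> nat" where
  "poly_denom f = (LEAST d. d > 0 \<and> (\<forall>i. coeff (smult (of_nat d) f) i \<in> \<int>))"

text \<open>
  The sum of the digits of \<open>x\<close> in base \<open>p \<ge> 2\<close>. The \<open>j\<close>-th digit is \<open>x div p ^ j mod p\<close>,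
  which vanishes for \<open>j > x\<close> because then \<open>p ^ j > x\<close>.
\<close>
definition digit_sum :: "nat \<Rightarrow> nat \<Rightarrow> nat" where
  "digit_sum p x = (\<Sum>j\<le>x. x div p ^ j mod p)"

lemma bernoulli_fps_mult:
  "Abs_fps (\<lambda>k. bernoulli k / fact k) * (fps_exp 1 - 1) = (fps_X :: rat fps)"
proof -
  have sd: "subdegree (fps_exp 1 - 1 :: rat fps) = 1"
    by (rule subdegreeI) auto
  have nz: "(fps_exp 1 - 1 :: rat fps) \<noteq> 0"
    using sd by auto
  have "Abs_fps (\<lambda>k. bernoulli k / fact k) = fps_X / (fps_exp 1 - 1)"
    by (simp add: fps_eq_iff bernoulli_def)
  moreover have "(fps_exp 1 - 1 :: rat fps) dvd fps_X"
    using nz sd by (simp add: fps_dvd_iff)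
  ultimately show ?thesis by simp
qed

lemma bernoulli_fps_complex:
  "Abs_fps (\<lambda>k. of_rat (bernoulli k) / fact k) = (fps_X / (fps_exp 1 - 1) :: complex fps)"
proof -
  define G where "G = (Abs_fps (\<lambda>k. of_rat (bernoulli k) / fact k) :: complex fps)"
  have of_rat_fact: "of_rat (fact k) = (fact k :: complex)" for k
    by (metis of_rat_of_nat_eq of_nat_fact)
  have "G * (fps_exp 1 - 1) = fps_X"
  proof (rule fps_ext)
    fix n
    have *: "of_rat (fps_nth (fps_exp 1 - 1) m) = (fps_nth (fps_exp 1 - 1) m :: complex)" for m
      by (simp add: of_rat_diff of_rat_divide of_rat_fact del: fact_Suc)
    have "fps_nth (G * (fps_exp 1 - 1)) n =
            of_rat (fps_nth (Abs_fps (\<lambda>k. bernoulli k / fact k) * (fps_exp 1 - 1)) n)"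
      by (simp only: fps_mult_nth of_rat_sum of_rat_mult * G_def fps_nth_Abs_fps of_rat_divide of_rat_fact)
    also have "\<dots> = fps_nth fps_X n"
      by (simp only: bernoulli_fps_mult) (simp add: fps_X_def)
    finally show "fps_nth (G * (fps_exp 1 - 1)) n = fps_nth fps_X n" .
  qed
  moreover have "subdegree (fps_exp 1 - 1 :: complex fps) = 1"
    by (rule subdegreeI) auto
  hence "(fps_exp 1 - 1 :: complex fps) \<noteq> 0" by auto
  ultimately have "G = fps_X / (fps_exp 1 - 1)"
    by (metis nonzero_mult_div_cancel_right)
  thus ?thesis by (simp add: G_def)
qed

text \<open>
  The formal definition of the Bernoulli numbers agrees with the analytic one; the value at
  \<open>t = 0\<close> is the continuous extension.
\<close>
lemma bernoulli_sums:
  fixes t :: complex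
  assumes "norm t < 2 * pi"
  shows "(\<lambda>k. of_rat (bernoulli k) * t ^ k / fact k) sums (if t = 0 then 1 else t / (exp t - 1))"
proof -
  define g :: "complex \<Rightarrow> complex" where "g = (\<lambda>t. if t = 0 then 1 else t / (exp t - 1))"
  have sd: "subdegree (fps_exp 1 - 1 :: complex fps) = 1"
    by (rule subdegreeI) auto
  have e: "g has_fps_expansion (fps_X / (fps_exp 1 - 1))"
    unfolding g_def
  proof (rule has_fps_expansion_divide)
    show "(\<lambda>t::complex. exp t - 1) has_fps_expansion (fps_exp 1 - 1)"
      by (intro fps_expansion_intros)
    show "subdegree (fps_exp 1 - 1 :: complex fps) \<le> subdegree (fps_X :: complex fps)" "fps_exp 1 - 1 \<noteq> (0 :: complex fps)"
      using sd by auto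
    show "(1::complex) = fps_nth fps_X (subdegree (fps_exp 1 - 1 :: complex fps))
             / fps_nth (fps_exp 1 - 1) (subdegree (fps_exp 1 - 1 :: complex fps))"
      unfolding sd by simp
  qed (intro fps_expansion_intros)
  have nz: "exp z \<noteq> 1" if "z \<noteq> 0" "norm z < 2 * pi" for z :: complex
  proof
    assume "exp z = 1"
    then obtain n :: int where n: "Re z = 0" "Im z = of_int (2 * n) * pi"
      by (auto simp: exp_eq_1)
    have "n \<noteq> 0" using n that(1) by (auto simp: complex_eq_iff)
    hence "1 \<le> \<bar>real_of_int n\<bar>" by linarith
    hence "2 * pi \<le> \<bar>Im z\<bar>" using n by (simp add: abs_mult)
    also have "\<dots> \<le> norm z" by (rule abs_Im_le_cmod)
    finally show False using that(2) by simp
  qed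
  let ?B = "ball 0 (2 * pi) :: complex set"
  have h: "g holomorphic_on ?B - {0}"
  proof -
    have "(\<lambda>t. t / (exp t - 1)) holomorphic_on ?B - {0}"
      using nz by (intro holomorphic_intros) auto
    thus ?thesis by (rule holomorphic_transform) (auto simp: g_def)
  qed
  have "continuous (at z) g" if "z \<in> ?B" for z
  proof (cases "z = 0")
    case True
    thus ?thesis using has_fps_expansion_imp_continuous[OF e, of UNIV] by simp
  next
    case False
    have "open (?B - {0})" by (intro open_delete) auto
    with holomorphic_on_imp_continuous_on[OF h] that False show ?thesis
      by (auto simp: continuous_on_eq_continuous_at)
  qed
  hence "continuous_on ?B g"
    by (auto intro: continuous_at_imp_continuous_on)
  hence "g holomorphic_on ?B"
    by (rule no_isolated_singularity) (use h in auto)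
  hence "g holomorphic_on eball 0 (ereal (2 * pi))"
    by (simp only: eball_ereal)
  moreover have "ereal (norm t) < ereal (2 * pi)"
    using assms by (simp only: ereal_less_eq less_ereal.simps)
  ultimately have "(\<lambda>k. fps_nth (fps_X / (fps_exp 1 - 1)) k * t ^ k) sums g t"
    by (rule has_fps_expansion_imp_sums_complex[OF e])
  thus ?thesis
    by (simp only: bernoulli_fps_complex[symmetric] g_def fps_nth_Abs_fps times_divide_eq_left)
qed

lemma poly_denom:
  shows poly_denom_pos: "poly_denom f > 0"
    and poly_denom_Ints: "coeff (smult (of_nat (poly_denom f)) f) i \<in> \<int>"
proof -
  define d where "d = (\<Prod>i\<le>degree f. rat_denom (coeff f i))"
  have pos: "rat_denom r > 0" for r
    using quotient_of_denom_pos'[of r] by (simp add: rat_denom_def)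
  have int: "of_nat (rat_denom r) * r \<in> \<int>" for r
  proof -
    obtain a b where ab: "quotient_of r = (a, b)" by force
    have "b > 0" using quotient_of_denom_pos[OF ab] .
    moreover have "r = of_int a / of_int b" using quotient_of_div[OF ab] .
    ultimately have "of_nat (rat_denom r) * r = of_int a"
      unfolding rat_denom_def ab by simp
    thus ?thesis by simp
  qed
  have "coeff (smult (of_nat d) f) i \<in> \<int>" for i
  proof (cases "i \<le> degree f")
    case True
    hence "rat_denom (coeff f i) dvd d" by (auto simp: d_def)
    then obtain k where "d = k * rat_denom (coeff f i)" by (metis dvdE mult.commute)
    hence "coeff (smult (of_nat d) f) i = of_nat k * (of_nat (rat_denom (coeff f i)) * coeff f i)"
      by simp
    also have "\<dots> \<in> \<int>" by (intro Ints_mult int) auto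
    finally show ?thesis .
  qed (simp add: coeff_eq_0)
  moreover have "d > 0" using pos by (auto simp: d_def intro!: prod_pos)
  ultimately have "d > 0 \<and> (\<forall>i. coeff (smult (of_nat d) f) i \<in> \<int>)"
    by blast
  hence "poly_denom f > 0 \<and> (\<forall>i. coeff (smult (of_nat (poly_denom f)) f) i \<in> \<int>)"
    unfolding poly_denom_def by (rule LeastI)
  thus "poly_denom f > 0" "coeff (smult (of_nat (poly_denom f)) f) i \<in> \<int>" by blast+
qed

lemma digit_sum_eq:
  assumes "p \<ge> 2" "\<And>j. j \<le> r \<Longrightarrow> \<alpha> j < p"
  shows "digit_sum p (\<Sum>j\<le>r. \<alpha> j * p ^ j) = (\<Sum>j\<le>r. \<alpha> j)"
proof -
  have digit: "(\<Sum>j\<le>r. \<beta> j * p ^ j) div p ^ i mod p = (if i \<le> r then \<beta> i else 0)"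
    if "\<And>j. j \<le> r \<Longrightarrow> \<beta> j < p" for i r and \<beta> :: "nat \<Rightarrow> nat"
    using that
  proof (induction r arbitrary: \<beta> i)
    case 0
    show ?case
    proof (cases i)
      case (Suc k)
      have "\<beta> 0 < p ^ Suc k"
        using "0.prems"[of 0] assms(1) less_le_trans[of "\<beta> 0" p "p ^ Suc k"]
        by (metis le0 self_le_power zero_less_Suc order.trans one_le_numeral)
      thus ?thesis by (simp add: Suc)
    qed (use 0 in auto)
  next
    case (Suc r)
    have eq: "(\<Sum>j\<le>Suc r. \<beta> j * p ^ j) = \<beta> 0 + p * (\<Sum>j\<le>r. \<beta> (Suc j) * p ^ j)"
      by (simp add: sum.atMost_Suc_shift sum_distrib_left mult_ac del: sum.atMost_Suc)
    show ?case
    proof (cases i)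
      case 0
      thus ?thesis unfolding eq using Suc.prems[of 0] by simp
    next
      case (Suc k)
      have "(\<beta> 0 + p * (\<Sum>j\<le>r. \<beta> (Suc j) * p ^ j)) div p ^ i =
              (\<Sum>j\<le>r. \<beta> (Suc j) * p ^ j) div p ^ k"
        using Suc.prems[of 0] assms(1) by (simp add: Suc div_mult2_eq)
      thus ?thesis unfolding eq using Suc.IH[of "\<lambda>j. \<beta> (Suc j)" k] Suc.prems Suc by simp
    qed
  qed
  define x where "x = (\<Sum>j\<le>r. \<alpha> j * p ^ j)"
  have zero: "x div p ^ j mod p = 0" if "j > x" for j
  proof -
    have "x < 2 ^ j" using that less_exp[of j] by linarith
    also have "\<dots> \<le> p ^ j" using assms(1) by (rule power_mono) simp
    finally show ?thesis by simp
  qed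
  have "digit_sum p x = (\<Sum>j\<le>max x r. x div p ^ j mod p)"
    unfolding digit_sum_def by (rule sum.mono_neutral_left) (auto simp: not_le zero)
  also have "\<dots> = (\<Sum>j\<le>r. x div p ^ j mod p)"
    by (rule sum.mono_neutral_right) (use assms(2) in \<open>auto simp: x_def digit\<close>)
  also have "\<dots> = (\<Sum>j\<le>r. \<alpha> j)"
    using assms(2) by (intro sum.cong) (auto simp: x_def digit)
  finally show ?thesis by (simp add: x_def)
qed

end

theory Submission
  imports "HOL-Number_Theory.Residue_Primitive_Roots" Defs
begin

text \<open>
  The coefficients of \<open>B\<^sub>n(x)\<close> are \<open>(n choose k) B\<^sub>k\<close>. By induction on \<open>n\<close>, the formula for
  \<open>0 ^ n + \<dots> + (p - 1) ^ n\<close> in terms of Bernoulli numbers shows that \<open>p B\<^sub>n\<close> is always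
  \<open>p\<close>-integral, and that for odd \<open>p\<close> and \<open>n > 0\<close> the number \<open>B\<^sub>n\<close> itself is \<open>p\<close>-integral iff
  \<open>p - 1\<close> does not divide \<open>n\<close> (von Staudt--Clausen). So the denominator is squarefree, and an odd
  prime \<open>p\<close> divides it iff \<open>p\<close> does not divide \<open>n choose k\<close> for some positive \<open>k \<le> n\<close> divisible by
  \<open>p - 1\<close>. By Legendre's formula, \<open>p\<close> does not divide \<open>n choose k\<close> iff
  \<open>s\<^sub>p(k) + s\<^sub>p(n - k) = s\<^sub>p(n)\<close>, and \<open>p - 1\<close> divides \<open>k\<close> iff it divides \<open>s\<^sub>p(k)\<close>. Hence such a
  \<open>k < n\<close> exists iff part of the digit sum of \<open>n\<close>, of size \<open>p - 1\<close>, can be split off with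
  something left over, i.e. iff \<open>s\<^sub>p(n) \<ge> p\<close>. The bounds on \<open>p\<close> in the theorem follow from
  \<open>s\<^sub>p(n) \<ge> p\<close> and parity.
\<close>

subsection \<open>Integrality at a prime\<close>

text \<open>For prime \<open>p\<close> this is membership in the localization of the integers at
  \<open>p\<close>. A natural multiplier prime to \<open>p\<close> serves as witness, so closure
  properties follow by multiplying witnesses.\<close>

definition p_integral :: "nat \<Rightarrow> rat \<Rightarrow> bool" where
  "p_integral p r \<longleftrightarrow> (\<exists>b::nat. \<not> p dvd b \<and> of_nat b * r \<in> \<int>)"

lemma p_integralI: "\<not> p dvd b \<Longrightarrow> of_nat b * r \<in> \<int> \<Longrightarrow> p_integral p r"
  unfolding p_integral_def by blast

lemma p_integral_Ints: "prime p \<Longrightarrow> r \<in> \<int> \<Longrightarrow> p_integral p r"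
  by (rule p_integralI[of _ 1]) (auto simp: prime_nat_iff)

lemma p_integral_of_nat: "prime p \<Longrightarrow> p_integral p (of_nat n)"
  by (simp add: p_integral_Ints)

lemma p_integral_add:
  assumes "prime p" "p_integral p r" "p_integral p s"
  shows "p_integral p (r + s)"
proof -
  obtain b c where b: "\<not> p dvd b" "of_nat b * r \<in> \<int>" and c: "\<not> p dvd c" "of_nat c * s \<in> \<int>"
    using assms by (auto simp: p_integral_def)
  have "of_nat (b * c) * (r + s) = of_nat c * (of_nat b * r) + of_nat b * (of_nat c * s)"
    by (simp add: algebra_simps)
  also have "\<dots> \<in> \<int>"
    by (metis Ints_add Ints_mult Ints_of_nat b(2) c(2))
  finally have int: "of_nat (b * c) * (r + s) \<in> \<int>" .
  have "\<not> p dvd b * c"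
    using b c assms(1) by (simp add: prime_dvd_mult_iff)
  from this int show ?thesis by (rule p_integralI)
qed

lemma p_integral_mult:
  assumes "prime p" "p_integral p r" "p_integral p s"
  shows "p_integral p (r * s)"
proof -
  obtain b c where b: "\<not> p dvd b" "of_nat b * r \<in> \<int>" and c: "\<not> p dvd c" "of_nat c * s \<in> \<int>"
    using assms by (auto simp: p_integral_def)
  have "of_nat (b * c) * (r * s) = (of_nat b * r) * (of_nat c * s)"
    by (simp add: algebra_simps)
  also have "\<dots> \<in> \<int>"
    using b(2) c(2) by (rule Ints_mult)
  finally have int: "of_nat (b * c) * (r * s) \<in> \<int>" .
  have "\<not> p dvd b * c"
    using b c assms(1) by (simp add: prime_dvd_mult_iff)
  from this int show ?thesis by (rule p_integralI)
qed

lemma p_integral_minus: "p_integral p r \<Longrightarrow> p_integral p (- r)"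
  unfolding p_integral_def by (metis Ints_minus mult_minus_right)

lemma p_integral_diff:
  "prime p \<Longrightarrow> p_integral p r \<Longrightarrow> p_integral p s \<Longrightarrow> p_integral p (r - s)"
  using p_integral_add[of p r "- s"] p_integral_minus[of p s] by simp

lemma p_integral_sum:
  assumes "prime p" "\<And>x. x \<in> A \<Longrightarrow> p_integral p (f x)"
  shows "p_integral p (sum f A)"
  using assms(2)
  by (induction A rule: infinite_finite_induct)
     (auto intro: p_integral_add p_integral_Ints assms(1))

lemma p_integral_of_nat_div:
  assumes "prime p"
  shows "p_integral p (of_nat a / of_nat p) \<longleftrightarrow> p dvd a"
proof
  assume "p_integral p (of_nat a / of_nat p)"
  then obtain b where b: "\<not> p dvd b" "of_nat b * (of_nat a / of_nat p :: rat) \<in> \<int>"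
    by (auto simp: p_integral_def)
  then obtain z :: int where "of_nat b * (of_nat a / of_nat p :: rat) = of_int z"
    by (auto elim: Ints_cases)
  hence "(of_int (int (b * a)) :: rat) = of_int (z * int p)"
    using assms by (simp add: field_simps)
  hence "int (b * a) = z * int p"
    by (simp only: of_int_eq_iff)
  hence "p dvd b * a"
    by (metis dvd_triv_right int_dvd_int_iff)
  thus "p dvd a"
    using assms b by (simp add: prime_dvd_mult_iff)
next
  assume "p dvd a"
  thus "p_integral p (of_nat a / of_nat p)"
    using assms by (auto intro!: p_integral_Ints elim!: dvdE)
qed

text \<open>If \<open>p ^ v\<close> exactly divides \<open>m\<close>, then
  \<open>p ^ v \<le> m < p ^ Suc k\<close> forces \<open>v \<le> k\<close>. This controls the
  denominators \<open>n + 1 - i\<close> in the power sum formula.\<close>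

lemma p_integral_prime_power_div:
  assumes "prime p" "m > 0" "m < p ^ Suc k"
  shows "p_integral p (of_nat p ^ k / of_nat m)"
proof -
  obtain c where c: "m = p ^ multiplicity p m * c" "\<not> p dvd c"
    using multiplicity_decompose'[of m p] assms by (metis not_prime_unit neq0_conv)
  define v where "v = multiplicity p m"
  have "p ^ v < p ^ Suc k"
    using assms c by (metis dvd_imp_le le_less_trans multiplicity_dvd v_def)
  hence "v \<le> k"
    using assms(1) by (metis less_Suc_eq_le power_less_imp_less_exp prime_gt_1_nat)
  hence "(of_nat p :: rat) ^ k = of_nat p ^ v * of_nat p ^ (k - v)"
    by (metis le_add_diff_inverse power_add)
  hence "(of_nat c :: rat) * (of_nat p ^ k / of_nat m) = of_nat (p ^ (k - v))"
    using assms(1,2) c by (simp add: c(1)[folded v_def])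
  hence "(of_nat c :: rat) * (of_nat p ^ k / of_nat m) \<in> \<int>"
    by (metis Ints_of_nat)
  thus ?thesis
    using c(2) by (rule p_integralI[rotated])
qed

subsection \<open>Denominators of Bernoulli numbers\<close>

text \<open>With \<open>B\<close> the generating function of the Bernoulli numbers and
  \<open>E = exp X\<close>, the geometric sum gives
  \<open>B * (E ^ m - 1) = X * (\<Sum>j<m. E ^ j)\<close>; the formula compares coefficients of
  degree \<open>n + 1\<close>.\<close>

lemma sum_powers_bernoulli:
  "(\<Sum>j<m. of_nat j ^ n) =
     (\<Sum>i\<le>n. of_nat (n choose i) * bernoulli i * of_nat m ^ (n + 1 - i) / of_nat (n + 1 - i))"
proof -
  define E :: "rat fps" where "E = fps_exp 1"
  define B where "B = Abs_fps (\<lambda>k. bernoulli k / fact k)"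
  have "B * (E ^ m - 1) = (B * (E - 1)) * (\<Sum>j<m. E ^ j)"
    by (subst power_diff_1_eq) (simp add: mult_ac)
  also have "\<dots> = fps_X * (\<Sum>j<m. E ^ j)"
    unfolding B_def E_def by (simp only: bernoulli_fps_mult)
  finally have "fps_nth (B * (E ^ m - 1)) (Suc n) = fps_nth (\<Sum>j<m. E ^ j) n"
    by simp
  also have "\<dots> = (\<Sum>j<m. of_nat j ^ n) / fact n"
    by (simp add: E_def fps_exp_power_mult fps_sum_nth sum_divide_distrib)
  finally have "(\<Sum>j<m. of_nat j ^ n) = fact n * fps_nth (B * (E ^ m - 1)) (Suc n)"
    by (simp del: fact_Suc)
  \<comment> \<open>The convolution runs up to \<open>Suc n\<close>, but its last term vanishes
    because \<open>E ^ m - 1\<close> has constant coefficient 0.\<close>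
  also have "\<dots> = fact n * (\<Sum>i\<le>n. bernoulli i / fact i * (of_nat m ^ (Suc n - i) / fact (Suc n - i)))"
    unfolding fps_mult_nth atLeast0AtMost sum.atMost_Suc E_def fps_exp_power_mult B_def
    by (simp del: fact_Suc)
  also have "\<dots> = (\<Sum>i\<le>n. of_nat (n choose i) * bernoulli i * of_nat m ^ (n + 1 - i) / of_nat (n + 1 - i))"
    unfolding sum_distrib_left
  proof (rule sum.cong)
    fix i assume "i \<in> {..n}"
    hence i: "i \<le> n" by simp
    hence "(of_nat (n choose i) :: rat) = fact n / (fact i * fact (n - i))"
      by (rule binomial_fact)
    moreover have "(fact (Suc n - i) :: rat) = of_nat (n + 1 - i) * fact (n - i)"
      using i by (simp add: Suc_diff_le)
    ultimately show "fact n * (bernoulli i / fact i * (of_nat m ^ (Suc n - i) / fact (Suc n - i))) =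
        of_nat (n choose i) * bernoulli i * of_nat m ^ (n + 1 - i) / of_nat (n + 1 - i)"
      by (simp add: mult_ac del: fact_Suc of_nat_Suc)
  qed simp
  finally show ?thesis .
qed

text \<open>If \<open>p - 1\<close> divides \<open>n\<close>, Fermat's theorem makes every nonzero
  residue contribute 1, so the sum is \<open>p - 1\<close> modulo \<open>p\<close>. Otherwise a
  primitive root \<open>g\<close> has \<open>g ^ n\<close> different from 1 modulo \<open>p\<close>,
  which forces the sum to vanish.\<close>

lemma prime_dvd_sum_powers_iff:
  fixes p n :: nat
  assumes "prime p" "n > 0"
  shows "p dvd (\<Sum>j<p. j ^ n) \<longleftrightarrow> \<not> (p - 1) dvd n"
proof (cases "(p - 1) dvd n")
  case True
  then obtain k where k: "n = (p - 1) * k" by blast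
  have "[(\<Sum>j\<in>{1..<p}. j ^ n) = (\<Sum>j\<in>{1..<p}. 1)] (mod p)"
  proof (rule cong_sum)
    fix j assume "j \<in> {1..<p}"
    hence "\<not> p dvd j" by (auto dest: dvd_imp_le)
    hence "[j ^ (p - 1) = 1] (mod p)" using assms by (intro fermat_theorem) auto
    thus "[j ^ n = 1] (mod p)" unfolding k power_mult by (metis cong_pow power_one)
  qed
  moreover have "(\<Sum>j<p. j ^ n) = (\<Sum>j\<in>{1..<p}. j ^ n)"
    using assms by (intro sum.mono_neutral_right) (auto simp: Suc_le_eq)
  ultimately have "[(\<Sum>j<p. j ^ n) = p - 1] (mod p)"
    by simp
  moreover have "\<not> p dvd p - 1"
    using prime_gt_1_nat[OF assms(1)] by (auto dest: dvd_imp_le)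
  ultimately show ?thesis
    using True by (simp add: cong_dvd_iff)
next
  case False
  have p1: "p > 1" using assms prime_gt_1_nat by blast
  obtain g where g: "residue_primroot p g"
    using prime_primitive_root_exists[OF p1 assms(1)] by auto
  hence cop: "coprime p g" and "ord p g = p - 1"
    using assms by (auto simp: residue_primroot_def totient_prime)
  hence ng: "\<not> [g ^ n = 1] (mod p)" using False unfolding ord_divides by simp
  define S where "S = (\<Sum>j<p. j ^ n)"
  txt \<open>Multiplication by a primitive root \<open>g\<close> permutes the residues, so the power sum \<open>S\<close> satisfies
    \<open>S \<equiv> g ^ n * S\<close>.\<close>
  have inj: "inj_on (\<lambda>j. (g * j) mod p) {..<p}"
  proof (rule inj_onI)
    fix i j assume ij: "i \<in> {..<p}" "j \<in> {..<p}" "(g * i) mod p = (g * j) mod p"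
    hence "[g * i = g * j] (mod p)" by (simp add: Cong.cong_def)
    hence "[i = j] (mod p)" using cop by (simp add: cong_mult_lcancel_nat coprime_commute)
    thus "i = j" using ij by (simp add: Cong.cong_def)
  qed
  have "(\<lambda>j. (g * j) mod p) ` {..<p} = {..<p}"
    by (rule endo_inj_surj[OF _ _ inj]) (use p1 in auto)
  hence "S = (\<Sum>j<p. ((g * j) mod p) ^ n)"
    unfolding S_def using sum.reindex[OF inj, of "\<lambda>j. j ^ n"] by (simp add: o_def)
  also have "[\<dots> = (\<Sum>j<p. (g * j) ^ n)] (mod p)"
    by (intro cong_sum cong_pow) (simp add: Cong.cong_def)
  also have "(\<Sum>j<p. (g * j) ^ n) = g ^ n * S"
    by (simp add: S_def sum_distrib_left power_mult_distrib)
  finally have S: "[1 * S = g ^ n * S] (mod p)" by simp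
  have "p dvd S"
  proof (rule ccontr)
    assume "\<not> p dvd S"
    hence "coprime S p" using assms(1) by (metis prime_imp_coprime coprime_commute)
    hence "[1 = g ^ n] (mod p)" using S by (simp only: cong_mult_rcancel_nat)
    thus False using ng by (simp add: cong_sym_eq)
  qed
  thus ?thesis using False by (simp add: S_def)
qed

text \<open>This solves \<open>sum_powers_bernoulli\<close> for its term \<open>i = n\<close>. One
  factor \<open>m\<close> is attached to each \<open>bernoulli i\<close>, because for prime
  \<open>m = p\<close> it is \<open>p * bernoulli i\<close> that is known to be
  \<open>p\<close>-integral.\<close>

lemma bernoulli_eq_sum_powers:
  assumes "m > 0"
  shows "bernoulli n = of_nat (\<Sum>j<m. j ^ n) / of_nat m -
     (\<Sum>i<n. of_nat (n choose i) * (of_nat m * bernoulli i) *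
              (of_nat m ^ (n - Suc i) / of_nat (Suc (n - i))))"
proof -
  have "of_nat (n choose i) * (of_nat m * bernoulli i) * (of_nat m ^ (n - Suc i) / of_nat (Suc (n - i)))
       = of_nat (n choose i) * bernoulli i * of_nat m ^ (n + 1 - i) / of_nat (n + 1 - i) / of_nat m"
    if "i < n" for i
  proof -
    obtain k where k: "n = Suc (i + k)"
      using \<open>i < n\<close> less_imp_Suc_add by blast
    show ?thesis
      unfolding k using assms by (simp add: Suc_diff_le)
  qed
  hence "(\<Sum>i<n. of_nat (n choose i) * (of_nat m * bernoulli i) *
              (of_nat m ^ (n - Suc i) / of_nat (Suc (n - i)))) =
        (\<Sum>i<n. of_nat (n choose i) * bernoulli i * of_nat m ^ (n + 1 - i) / of_nat (n + 1 - i)) / of_nat m"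
    unfolding sum_divide_distrib by (intro sum.cong) auto
  moreover have "(\<Sum>j<m. of_nat j ^ n) =
      (\<Sum>i<n. of_nat (n choose i) * bernoulli i * of_nat m ^ (n + 1 - i) / of_nat (n + 1 - i))
      + bernoulli n * of_nat m"
    unfolding sum_powers_bernoulli lessThan_Suc_atMost[symmetric] sum.lessThan_Suc by simp
  ultimately show ?thesis
    using assms by (simp add: add_divide_distrib)
qed

text \<open>Multiplying \<open>bernoulli_eq_sum_powers\<close> by \<open>p\<close> raises the power
  of \<open>p\<close> in each term to \<open>n - i\<close>, which is enough to absorb the
  denominator \<open>n - i + 1\<close> for every prime. The remaining factors are integral by
  induction.\<close>

lemma p_integral_p_mult_bernoulli:
  assumes "prime p"
  shows "p_integral p (of_nat p * bernoulli n)"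
proof (induction n rule: less_induct)
  case (less n)
  have p0: "p > 0" using assms prime_gt_0_nat by blast
  have "of_nat p * bernoulli n = of_nat (\<Sum>j<p. j ^ n) -
     (\<Sum>i<n. of_nat (n choose i) * (of_nat p * bernoulli i) *
              (of_nat p ^ (n - i) / of_nat (Suc (n - i))))"
  proof -
    have eq: "of_nat p * (of_nat (n choose i) * (of_nat p * bernoulli i) *
              (of_nat p ^ (n - Suc i) / of_nat (Suc (n - i))))
         = of_nat (n choose i) * (of_nat p * bernoulli i) *
              (of_nat p ^ (n - i) / of_nat (Suc (n - i)))" if "i < n" for i
      using that by (simp add: Suc_diff_Suc[symmetric] del: of_nat_Suc)
    show ?thesis
      unfolding bernoulli_eq_sum_powers[OF p0, of n] right_diff_distrib sum_distrib_left
      using p0 eq by (intro arg_cong2[of _ _ _ _ "(-)"] sum.cong) auto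
  qed
  also have "p_integral p \<dots>"
  proof (intro p_integral_diff p_integral_sum p_integral_of_nat assms)
    fix i assume "i \<in> {..<n}"
    hence int: "p_integral p (of_nat p * bernoulli i)" by (simp add: less.IH)
    have "Suc (n - i) < 2 ^ Suc (n - i)" by (rule less_exp)
    also have "\<dots> \<le> p ^ Suc (n - i)" using prime_ge_2_nat[OF assms] by (intro power_mono) auto
    finally have "p_integral p (of_nat p ^ (n - i) / of_nat (Suc (n - i)))"
      using assms by (intro p_integral_prime_power_div) auto
    with int show "p_integral p (of_nat (n choose i) * (of_nat p * bernoulli i) *
              (of_nat p ^ (n - i) / of_nat (Suc (n - i))))"
      by (rule p_integral_mult[OF assms p_integral_mult[OF assms p_integral_of_nat[OF assms]]])
  qed
  finally show ?case .
qed

text \<open>This is the size condition for dividing \<open>p ^ k\<close> by \<open>k + 2\<close>. In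
  the excluded case \<open>p = 2\<close>, \<open>k = 0\<close> it would read 2 < 2.\<close>

lemma add_2_less_power:
  assumes "(p::nat) \<ge> 2" "p > 2 \<or> k > 0"
  shows "Suc (Suc k) < p ^ Suc k"
  using assms(2)
proof
  assume "p > 2"
  have "Suc k < 2 ^ Suc k" by (rule less_exp)
  moreover have "2 ^ Suc k < p ^ Suc k" using \<open>p > 2\<close> by (intro power_strict_mono) auto
  ultimately show ?thesis by linarith
next
  assume "k > 0"
  then obtain l where l: "k = Suc l" by (cases k) auto
  have "l < 2 ^ l" by (rule less_exp)
  hence "Suc (Suc k) < 2 ^ Suc k" unfolding l power_Suc by linarith
  also have "\<dots> \<le> p ^ Suc k" using assms by (intro power_mono) auto
  finally show ?thesis .
qed

text \<open>Modulo \<open>p\<close>-integral numbers, \<open>bernoulli n\<close> equals the power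
  sum of the residues divided by \<open>p\<close>, so the criterion for \<open>p\<close> to divide
  that power sum decides.\<close>

theorem p_integral_bernoulli_iff:
  assumes "prime p" "n > 0" "odd p \<or> even n"
  shows "p_integral p (bernoulli n) \<longleftrightarrow> \<not> (p - 1) dvd n"
proof -
  define t where "t = (\<lambda>i. of_nat (n choose i) * (of_nat p * bernoulli i) *
              (of_nat p ^ (n - Suc i) / of_nat (Suc (n - i))))"
  have "p_integral p (t i)" if "i < n" for i
  proof (cases "p = 2 \<and> n = Suc i")
    case True
    hence "even n" using assms(3) by auto
    then obtain c where c: "n = 2 * c" by blast
    \<comment> \<open>Here the last factor of \<open>t i\<close> is 1/2, and the even binomial
      coefficient \<open>n choose i = n\<close> cancels it.\<close>
    have "t i = of_nat c * (of_nat p * bernoulli i)"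
      using True c by (simp add: t_def)
    also have "p_integral p \<dots>"
      by (intro p_integral_mult p_integral_p_mult_bernoulli assms(1) p_integral_Ints) auto
    finally show ?thesis .
  next
    case False
    hence "Suc (Suc (n - Suc i)) < p ^ Suc (n - Suc i)"
      using prime_ge_2_nat[OF assms(1)] \<open>i < n\<close> by (intro add_2_less_power) auto
    moreover have "Suc (Suc (n - Suc i)) = Suc (n - i)"
      using \<open>i < n\<close> by simp
    ultimately have "p_integral p (of_nat p ^ (n - Suc i) / of_nat (Suc (n - i)))"
      using assms(1) by (intro p_integral_prime_power_div) (simp_all only: zero_less_Suc)
    thus ?thesis unfolding t_def
      by (intro p_integral_mult[OF assms(1)] p_integral_of_nat p_integral_p_mult_bernoulli assms(1))
  qed
  hence t: "p_integral p (\<Sum>i<n. t i)"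
    using assms(1) by (intro p_integral_sum) auto
  have eq: "bernoulli n = of_nat (\<Sum>j<p. j ^ n) / of_nat p - (\<Sum>i<n. t i)"
    unfolding t_def using assms(1) prime_gt_0_nat by (intro bernoulli_eq_sum_powers) auto
  hence eq': "of_nat (\<Sum>j<p. j ^ n) / of_nat p = bernoulli n + (\<Sum>i<n. t i)"
    by simp
  have "p_integral p (bernoulli n) \<longleftrightarrow> p_integral p (of_nat (\<Sum>j<p. j ^ n) / of_nat p)"
    using eq eq' t assms(1) p_integral_add p_integral_diff by metis
  also have "\<dots> \<longleftrightarrow> \<not> (p - 1) dvd n"
    using assms by (simp only: p_integral_of_nat_div prime_dvd_sum_powers_iff)
  finally show ?thesis .
qed

lemma bernoulli_0: "bernoulli 0 = 1"
  using bernoulli_eq_sum_powers[of 1 0] by simp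

lemma bernoulli_1: "bernoulli 1 = - 1 / 2"
  using bernoulli_eq_sum_powers[of 1 1] by (simp add: bernoulli_0)

text \<open>The value at 1 makes the polynomial denominators even for odd \<open>n\<close>, a case
  outside \<open>p_integral_bernoulli_iff\<close> at the prime 2.\<close>

lemma not_2_integral_bernoulli_1: "\<not> p_integral 2 (bernoulli 1)"
proof
  assume "p_integral 2 (bernoulli 1)"
  hence "p_integral 2 (of_nat 1 / of_nat 2)"
    using p_integral_minus[of 2 "- 1 / 2"] unfolding bernoulli_1 by simp
  thus False
    by (subst (asm) p_integral_of_nat_div) auto
qed

subsection \<open>Denominators of polynomials\<close>

lemma rat_denom_dvd:
  assumes "of_nat d * r \<in> \<int>"
  shows "rat_denom r dvd d"
proof -
  obtain a b where ab: "quotient_of r = (a, b)" by force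
  have b: "b > 0" "coprime a b" "r = of_int a / of_int b"
    using quotient_of_denom_pos[OF ab] quotient_of_coprime[OF ab] quotient_of_div[OF ab] by auto
  obtain z where z: "of_nat d * r = of_int z" using assms by (auto elim: Ints_cases)
  hence "(of_int (int d * a) :: rat) = of_int (z * b)"
    using b by (simp add: field_simps)
  hence "int d * a = z * b" by (simp only: of_int_eq_iff)
  hence "b dvd int d * a" by simp
  hence "b dvd int d" using b(2) by (simp add: coprime_dvd_mult_left_iff coprime_commute)
  thus ?thesis
    using b(1) by (simp add: rat_denom_def ab nat_dvd_iff)
qed

text \<open>The multipliers that clear all denominators are closed under remainders, so a nonzero
  \<open>d mod poly_denom f\<close> would be a smaller one.\<close>

lemma poly_denom_dvd:
  assumes "\<And>i. of_nat d * coeff f i \<in> \<int>"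
  shows "poly_denom f dvd d"
proof (rule ccontr)
  define D where "D = poly_denom f"
  assume "\<not> poly_denom f dvd d"
  hence pos: "d mod D > 0" by (simp add: D_def dvd_eq_mod_eq_0)
  have "of_nat (d mod D) * coeff f i \<in> \<int>" for i
  proof -
    have "of_nat d = (of_nat (d div D) * of_nat D + of_nat (d mod D) :: rat)"
      by (metis div_mult_mod_eq of_nat_add of_nat_mult)
    hence "of_nat (d mod D) * coeff f i =
        of_nat d * coeff f i - of_nat (d div D) * coeff (smult (of_nat D) f) i"
      by (simp add: algebra_simps)
    also have "\<dots> \<in> \<int>"
      unfolding D_def by (intro Ints_diff Ints_mult[OF Ints_of_nat] assms poly_denom_Ints)
    finally show ?thesis .
  qed
  hence "poly_denom f \<le> d mod D"
    unfolding poly_denom_def using pos by (intro Least_le) auto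
  thus False
    using mod_less_divisor[of D d] poly_denom_pos[of f] unfolding D_def by linarith
qed

text \<open>Only finitely many coefficients are nonzero, and a product of multipliers prime to
  \<open>p\<close> is again prime to \<open>p\<close>.\<close>

lemma p_integral_common_denom:
  fixes f :: "rat poly"
  assumes "prime p" "\<And>i. p_integral p (coeff f i)"
  obtains b where "\<not> p dvd b" "\<And>i. of_nat b * coeff f i \<in> \<int>"
proof -
  obtain b where b: "\<And>i. \<not> p dvd b i" "\<And>i. of_nat (b i) * coeff f i \<in> \<int>"
    using assms(2) unfolding p_integral_def by metis
  define c where "c = (\<Prod>i\<le>degree f. b i)"
  have "of_nat c * coeff f i \<in> \<int>" for i
  proof (cases "i \<le> degree f")
    case True
    hence "b i dvd c" by (auto simp: c_def)
    then obtain k where "c = k * b i" by (metis dvdE mult.commute)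
    hence "of_nat c * coeff f i = of_nat k * (of_nat (b i) * coeff f i)" by simp
    also have "\<dots> \<in> \<int>" by (rule Ints_mult[OF Ints_of_nat b(2)])
    finally show ?thesis .
  qed (simp add: coeff_eq_0)
  moreover have "\<not> p dvd c"
    using assms(1) b(1) by (simp add: c_def prime_dvd_prod_iff)
  ultimately show ?thesis using that by blast
qed

text \<open>If all coefficients are \<open>p\<close>-integral, \<open>poly_denom f\<close> divides a
  common multiplier prime to \<open>p\<close>. Conversely, if \<open>p\<close> does not divide
  \<open>poly_denom f\<close>, then \<open>poly_denom f\<close> itself witnesses integrality of
  every coefficient.\<close>

lemma prime_dvd_poly_denom_iff:
  assumes "prime p"
  shows "p dvd poly_denom f \<longleftrightarrow> (\<exists>i. \<not> p_integral p (coeff f i))"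
proof
  assume "p dvd poly_denom f"
  thus "\<exists>i. \<not> p_integral p (coeff f i)"
    using p_integral_common_denom[OF assms, of f] poly_denom_dvd[of _ f] dvd_trans by metis
next
  assume "\<exists>i. \<not> p_integral p (coeff f i)"
  thus "p dvd poly_denom f"
    using poly_denom_Ints[of f] p_integralI[of p "poly_denom f"] by auto
qed

text \<open>A common multiplier \<open>b\<close> for \<open>p * f\<close> that is prime to
  \<open>p\<close> shows that \<open>poly_denom f\<close> divides \<open>b * p\<close>.\<close>

lemma not_prime_square_dvd_poly_denom:
  assumes "prime p" "\<And>i. p_integral p (of_nat p * coeff f i)"
  shows "\<not> p ^ 2 dvd poly_denom f"
proof
  assume "p ^ 2 dvd poly_denom f"
  obtain b where b: "\<not> p dvd b" "\<And>i. of_nat b * coeff (smult (of_nat p) f) i \<in> \<int>"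
    using p_integral_common_denom[of p "smult (of_nat p) f"] assms by auto
  hence "poly_denom f dvd b * p"
    by (intro poly_denom_dvd) (simp add: mult_ac)
  with \<open>p ^ 2 dvd poly_denom f\<close> have "p ^ 2 dvd b * p" by (rule dvd_trans)
  thus False
    using b(1) assms(1) by (simp add: power2_eq_square)
qed

lemma squarefree_eq_prod_primes:
  fixes d :: nat
  assumes "squarefree d"
  shows "d = \<Prod>{p. prime p \<and> p dvd d}"
proof -
  have "d \<noteq> 0" using assms by (intro notI) simp
  hence "d = (\<Prod>p\<in>prime_factors d. p ^ multiplicity p d)"
    by (simp add: prod_prime_factors)
  also have "\<dots> = \<Prod>(prime_factors d)"
    using assms \<open>d \<noteq> 0\<close> by (intro prod.cong) (auto simp: squarefree_factorial_semiring')
  also have "prime_factors d = {p. prime p \<and> p dvd d}"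
    using \<open>d \<noteq> 0\<close> by (auto simp: prime_factors_dvd)
  finally show ?thesis .
qed

section \<open>Coefficients of Bernoulli polynomials at a prime\<close>

lemma coeff_bernpoly:
  "coeff (bernpoly n) i = (if i \<le> n then of_nat (n choose i) * bernoulli (n - i) else 0)"
proof -
  have "coeff (bernpoly n) i = (\<Sum>k\<le>n. if k = n - i \<and> i \<le> n then of_nat (n choose k) * bernoulli k else 0)"
    unfolding bernpoly_def coeff_sum by (intro sum.cong) auto
  also have "\<dots> = (if i \<le> n then of_nat (n choose (n - i)) * bernoulli (n - i) else 0)"
    by (cases "i \<le> n") (simp_all add: sum.delta)
  finally show ?thesis
    using binomial_symmetric[of i n] by simp
qed

lemma squarefree_poly_denom_bernpoly: "squarefree (poly_denom (bernpoly n))"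
proof -
  have "\<not> p ^ 2 dvd poly_denom (bernpoly n)" if "prime p" for p
  proof (rule not_prime_square_dvd_poly_denom[OF that])
    fix i
    have "p_integral p (of_nat (n choose i) * (of_nat p * bernoulli (n - i)))"
      using that by (intro p_integral_mult p_integral_p_mult_bernoulli p_integral_Ints) auto
    thus "p_integral p (of_nat p * coeff (bernpoly n) i)"
      using that by (auto simp: coeff_bernpoly mult_ac p_integral_Ints)
  qed
  thus ?thesis
    using poly_denom_pos[of "bernpoly n"] by (subst squarefree_factorial_semiring) auto
qed

text \<open>Since \<open>p * bernoulli k\<close> is \<open>p\<close>-integral, a single factor
  \<open>p\<close> in \<open>n choose k\<close> already makes the coefficient integral; a binomial
  coefficient prime to \<open>p\<close> changes nothing.\<close>

lemma prime_dvd_poly_denom_bernpoly_iff: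
  assumes "prime p"
  shows "p dvd poly_denom (bernpoly n) \<longleftrightarrow>
    (\<exists>k\<le>n. \<not> p dvd (n choose k) \<and> \<not> p_integral p (bernoulli k))"
proof -
  have int: "p_integral p (of_nat c * bernoulli k) \<longleftrightarrow> p dvd c \<or> p_integral p (bernoulli k)" for c k
  proof
    assume "p_integral p (of_nat c * bernoulli k)"
    then obtain b where b: "\<not> p dvd b" "of_nat b * (of_nat c * bernoulli k) \<in> \<int>"
      by (auto simp: p_integral_def)
    hence "p_integral p (bernoulli k)" if "\<not> p dvd c"
      using that assms by (intro p_integralI[of p "b * c"]) (simp_all add: prime_dvd_mult_iff mult_ac)
    thus "p dvd c \<or> p_integral p (bernoulli k)" by blast
  next
    assume "p dvd c \<or> p_integral p (bernoulli k)"
    thus "p_integral p (of_nat c * bernoulli k)"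
    proof
      assume "p dvd c"
      then obtain d where "c = p * d" by blast
      hence "of_nat c * bernoulli k = of_nat d * (of_nat p * bernoulli k)" by simp
      also have "p_integral p \<dots>"
        using assms by (intro p_integral_mult p_integral_p_mult_bernoulli p_integral_Ints) auto
      finally show ?thesis .
    qed (rule p_integral_mult[OF assms p_integral_of_nat[OF assms]])
  qed
  have "p dvd poly_denom (bernpoly n) \<longleftrightarrow>
      (\<exists>i\<le>n. \<not> p dvd (n choose i) \<and> \<not> p_integral p (bernoulli (n - i)))"
    using assms int by (auto simp: prime_dvd_poly_denom_iff coeff_bernpoly p_integral_Ints)
  also have "\<dots> \<longleftrightarrow> (\<exists>k\<le>n. \<not> p dvd (n choose k) \<and> \<not> p_integral p (bernoulli k))"
    by (metis binomial_symmetric diff_diff_cancel diff_le_self)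
  finally show ?thesis .
qed

subsection \<open>Digit sums and binomial coefficients\<close>

lemma digit_sum_eq_sum_atMost:
  assumes "p \<ge> 2" "x \<le> N"
  shows "digit_sum p x = (\<Sum>j\<le>N. x div p ^ j mod p)"
  unfolding digit_sum_def
proof (rule sum.mono_neutral_left)
  show "\<forall>j\<in>{..N} - {..x}. x div p ^ j mod p = 0"
  proof
    fix j assume "j \<in> {..N} - {..x}"
    hence "x < j" by simp
    also have "j < 2 ^ j" by (rule less_exp)
    also have "\<dots> \<le> p ^ j" using assms(1) by (rule power_mono) simp
    finally show "x div p ^ j mod p = 0" by simp
  qed
qed (use assms in auto)

lemma digit_sum_rec:
  assumes "p \<ge> 2"
  shows "digit_sum p x = x mod p + digit_sum p (x div p)"
proof -
  have "digit_sum p x = (\<Sum>j\<le>Suc x. x div p ^ j mod p)"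
    using assms by (intro digit_sum_eq_sum_atMost) auto
  also have "\<dots> = x mod p + (\<Sum>j\<le>x. x div p div p ^ j mod p)"
    unfolding sum.atMost_Suc_shift by (simp add: div_mult2_eq)
  also have "(\<Sum>j\<le>x. x div p div p ^ j mod p) = digit_sum p (x div p)"
    using assms by (intro digit_sum_eq_sum_atMost[symmetric]) auto
  finally show ?thesis .
qed

lemma digit_sum_0 [simp]: "digit_sum p 0 = 0"
  by (simp add: digit_sum_def)

lemma digit_sum_less: "p \<ge> 2 \<Longrightarrow> x < p \<Longrightarrow> digit_sum p x = x"
  by (subst digit_sum_rec) auto

lemma digit_sum_mult_add:
  "p \<ge> 2 \<Longrightarrow> r < p \<Longrightarrow> digit_sum p (p * q + r) = digit_sum p q + r"
  by (subst digit_sum_rec) auto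

lemma digit_sum_pos:
  assumes "p \<ge> 2" "n > 0"
  shows "digit_sum p n > 0"
  using assms(2)
proof (induction n rule: less_induct)
  case (less n)
  show ?case
  proof (cases "n < p")
    case False
    hence "n div p > 0" "n div p < n"
      using assms less.prems by (auto simp: div_greater_zero_iff)
    thus ?thesis
      using less.IH[of "n div p"] digit_sum_rec[OF assms(1), of n] by simp
  qed (use less.prems digit_sum_less[OF assms(1)] in auto)
qed

text \<open>Adding 1 turns each trailing digit \<open>p - 1\<close> into 0 and raises the next digit
  by 1. The number of these trailing digits is the multiplicity of \<open>p\<close> in
  \<open>Suc n\<close>. The induction strips the last digit.\<close>

lemma digit_sum_Suc:
  assumes "prime p"
  shows "digit_sum p n + 1 = digit_sum p (Suc n) + (p - 1) * multiplicity p (Suc n)"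
proof (induction n rule: less_induct)
  case (less n)
  have p2: "p \<ge> 2" using assms by (rule prime_ge_2_nat)
  show ?case
  proof (cases "p dvd Suc n")
    case False
    hence "Suc (n mod p) < p"
      using p2 mod_less_divisor[of p n] by (metis Suc_lessI dvd_eq_mod_eq_0 mod_Suc not_numeral_le_zero neq0_conv)
    have n: "n = p * (n div p) + n mod p" by simp
    have "digit_sum p n = digit_sum p (n div p) + n mod p"
      by (subst n, subst digit_sum_mult_add) (use p2 in auto)
    moreover have "Suc n = p * (n div p) + Suc (n mod p)" by simp
    hence "digit_sum p (Suc n) = digit_sum p (n div p) + Suc (n mod p)"
      using digit_sum_mult_add[OF p2 \<open>Suc (n mod p) < p\<close>] by metis
    moreover have "multiplicity p (Suc n) = 0"
      using False by (rule not_dvd_imp_multiplicity_0)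
    ultimately show ?thesis by simp
  next
    case True
    then obtain m where m: "Suc n = p * m" by blast
    then obtain l where l: "m = Suc l" by (cases m) auto
    have n: "n = p * l + (p - 1)" using m l p2 by simp
    have "digit_sum p n = digit_sum p l + (p - 1)"
      unfolding n using p2 by (intro digit_sum_mult_add) auto
    moreover have "digit_sum p (Suc n) = digit_sum p (Suc l)"
      using digit_sum_mult_add[of p 0 m] p2 m l by simp
    moreover have "multiplicity p (Suc n) = Suc (multiplicity p (Suc l))"
      unfolding m l using assms by (intro multiplicity_times_same) auto
    moreover have "l < p * l + (p - 1)"
    proof -
      have "1 * l \<le> p * l" using p2 by (intro mult_right_mono) auto
      thus ?thesis using p2 by linarith
    qed
    hence "digit_sum p l + 1 = digit_sum p (Suc l) + (p - 1) * multiplicity p (Suc l)"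
      using less.IH[of l] n by simp
    ultimately show ?thesis by simp
  qed
qed

text \<open>Summing \<open>digit_sum_Suc\<close> telescopes, since the multiplicities of 1 to
  \<open>n\<close> add up to that of \<open>fact n\<close>.\<close>

theorem legendre_digit_sum:
  assumes "prime p"
  shows "(p - 1) * multiplicity p (fact n :: nat) + digit_sum p n = n"
proof (induction n)
  case (Suc n)
  have "multiplicity p (fact (Suc n) :: nat) = multiplicity p (Suc n) + multiplicity p (fact n :: nat)"
    unfolding fact_Suc of_nat_id using assms by (intro prime_elem_multiplicity_mult_distrib) auto
  thus ?case
    using Suc digit_sum_Suc[OF assms, of n] by (simp add: distrib_left)
qed simp

text \<open>By Legendre's formula for \<open>n\<close>, \<open>k\<close> and \<open>n - k\<close>,
  the excess of the two digit sums over \<open>digit_sum p n\<close> is \<open>p - 1\<close> times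
  the multiplicity of \<open>p\<close> in the binomial coefficient (Kummer's carry count).\<close>

lemma prime_not_dvd_binomial_iff:
  assumes "prime p" "k \<le> n"
  shows "\<not> p dvd (n choose k) \<longleftrightarrow> digit_sum p k + digit_sum p (n - k) = digit_sum p n"
proof -
  have "multiplicity p (fact n :: nat) = multiplicity p (fact k * fact (n - k) * (n choose k) :: nat)"
    by (simp only: binomial_fact_lemma[OF assms(2)])
  also have "\<dots> = multiplicity p (fact k :: nat) + multiplicity p (fact (n - k) :: nat) + multiplicity p (n choose k)"
    using assms by (simp add: prime_elem_multiplicity_mult_distrib)
  finally have "(p - 1) * multiplicity p (fact n :: nat) =
      (p - 1) * multiplicity p (fact k :: nat) + (p - 1) * multiplicity p (fact (n - k) :: nat)
      + (p - 1) * multiplicity p (n choose k)"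
    by (simp add: distrib_left)
  hence "digit_sum p k + digit_sum p (n - k) = digit_sum p n + (p - 1) * multiplicity p (n choose k)"
    using legendre_digit_sum[OF assms(1), of n] legendre_digit_sum[OF assms(1), of k]
      legendre_digit_sum[OF assms(1), of "n - k"] assms(2) by linarith
  moreover have "p dvd (n choose k) \<longleftrightarrow> multiplicity p (n choose k) > 0"
    using assms by (simp add: prime_multiplicity_gt_zero_iff)
  ultimately show ?thesis
    using prime_gt_1_nat[OF assms(1)] by auto
qed

text \<open>The amount \<open>s\<close> is taken greedily from the digits of \<open>n\<close>,
  highest first. Each digit of \<open>k\<close> is at most that of \<open>n\<close>, so the
  subtraction \<open>n - k\<close> needs no borrowing.\<close>

lemma digit_sum_split:
  assumes "p \<ge> 2" "s \<le> digit_sum p n"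
  shows "\<exists>k\<le>n. digit_sum p k = s \<and> digit_sum p (n - k) = digit_sum p n - s"
  using assms(2)
proof (induction n arbitrary: s rule: less_induct)
  case (less n)
  define q r where "q = n div p" and "r = n mod p"
  have r: "r < p" and n: "n = p * q + r"
    using assms(1) by (auto simp: q_def r_def)
  have dn: "digit_sum p n = digit_sum p q + r"
    unfolding n using assms(1) r by (rule digit_sum_mult_add)
  show ?case
  \<comment> \<open>If \<open>s\<close> exceeds the sum of the higher digits, all of these are taken
    together with \<open>j\<close> from the last digit. The value \<open>n = 0\<close> belongs here
    because \<open>q < n\<close> fails for it.\<close>
  proof (cases "n = 0 \<or> s > digit_sum p q")
    case True
    define j where "j = s - digit_sum p q"
    have j: "j \<le> r" "s = digit_sum p q + j"
      using True less.prems dn by (auto simp: j_def q_def)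
    have "digit_sum p (p * q + j) = s"
      using digit_sum_mult_add[OF assms(1), of j q] j r by simp
    moreover have "digit_sum p (n - (p * q + j)) = digit_sum p n - s"
      using digit_sum_less[OF assms(1), of "r - j"] j r dn n by simp
    ultimately show ?thesis
      using j n by (intro exI[of _ "p * q + j"]) auto
  next
    case False
    hence "q < n" using assms(1) by (auto simp: q_def)
    then obtain k where k: "k \<le> q" "digit_sum p k = s" "digit_sum p (q - k) = digit_sum p q - s"
      using less.IH[of q s] False by auto
    have "n - p * k = p * (q - k) + r"
      using k(1) n by (simp add: right_diff_distrib')
    hence "digit_sum p (n - p * k) = digit_sum p n - s"
      using digit_sum_mult_add[OF assms(1) r, of "q - k"] k dn False by simp
    moreover have "digit_sum p (p * k) = s"
      using digit_sum_mult_add[OF assms(1), of 0 k] k assms(1) by simp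
    moreover have "p * k \<le> n" using k(1) n by (simp add: trans_le_add1)
    ultimately show ?thesis by blast
  qed
qed

text \<open>Legendre's formula gives that \<open>k\<close> and \<open>digit_sum p k\<close> agree
  modulo \<open>p - 1\<close>. Thus \<open>k\<close> uses at least \<open>p - 1\<close> of the digit
  sum of \<open>n\<close> and \<open>n - k\<close> at least 1; conversely, a part of size exactly
  \<open>p - 1\<close> can be split off.\<close>

lemma ex_binomial_not_dvd_iff:
  assumes "prime p"
  shows "(\<exists>k. 0 < k \<and> k < n \<and> (p - 1) dvd k \<and> \<not> p dvd (n choose k)) \<longleftrightarrow> p \<le> digit_sum p n"
    (is "?lhs \<longleftrightarrow> ?rhs")
proof -
  have p2: "p \<ge> 2" using assms by (rule prime_ge_2_nat)
  have dvd: "(p - 1) dvd k \<longleftrightarrow> (p - 1) dvd digit_sum p k" for k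
  proof -
    have "(p - 1) dvd (p - 1) * multiplicity p (fact k :: nat) + digit_sum p k \<longleftrightarrow> (p - 1) dvd digit_sum p k"
      by (rule dvd_add_right_iff) simp
    thus ?thesis by (simp only: legendre_digit_sum[OF assms])
  qed
  have "?rhs" if ex: "?lhs"
  proof -
    obtain k where k: "0 < k" "k < n" "(p - 1) dvd k" "\<not> p dvd (n choose k)"
      using ex by (elim exE conjE)
    have "(p - 1) dvd digit_sum p k" using k(3) dvd by blast
    hence "p - 1 \<le> digit_sum p k"
      using digit_sum_pos[OF p2 k(1)] by (rule dvd_imp_le)
    moreover have "digit_sum p (n - k) > 0"
      using k digit_sum_pos[OF p2] by simp
    moreover have "digit_sum p k + digit_sum p (n - k) = digit_sum p n"
      using k prime_not_dvd_binomial_iff[OF assms, of k n] by simp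
    ultimately show ?thesis by linarith
  qed
  moreover have "?lhs" if le: "?rhs"
  proof -
    have "p - 1 \<le> digit_sum p n" using le by simp
    from digit_sum_split[OF p2 this] obtain k
      where k: "k \<le> n" "digit_sum p k = p - 1" "digit_sum p (n - k) = digit_sum p n - (p - 1)"
      by blast
    \<comment> \<open>The two parts have digit sums \<open>p - 1\<close> and
      \<open>digit_sum p n - (p - 1)\<close>, both positive, so \<open>k\<close> is neither 0 nor
      \<open>n\<close>.\<close>
    have "k > 0" using k(2) p2 by (intro gr0I) auto
    moreover have "k \<noteq> n" using k(3) le p2 by auto
    moreover have "\<not> p dvd (n choose k)"
      using k le prime_not_dvd_binomial_iff[OF assms, of k n] by simp
    moreover have "(p - 1) dvd k" unfolding dvd[of k] k(2) by simp
    ultimately show ?thesis using k(1) by (intro exI[of _ k]) auto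
  qed
  ultimately show ?thesis by blast
qed

text \<open>Below \<open>2 * p - 1\<close> the leading part \<open>q\<close> is 0 or 1. A single
  digit is less than \<open>p\<close>, and with \<open>q = 1\<close> the digit sum reaches
  \<open>p\<close> only at \<open>n = 2 * p - 1\<close>.\<close>

lemma digit_sum_ge_imp_double_le:
  assumes "p \<ge> 2" "p \<le> digit_sum p n"
  shows "2 * p \<le> n + 1"
proof (rule ccontr)
  assume *: "\<not> 2 * p \<le> n + 1"
  define q r where "q = n div p" and "r = n mod p"
  have r: "r < p" and n: "n = p * q + r"
    using assms(1) by (auto simp: q_def r_def)
  have "q < 2"
    using * assms(1) unfolding q_def by (simp add: div_less_iff_less_mult)
  moreover from this have "p \<le> q + r"
    using assms digit_sum_mult_add[OF assms(1) r, of q] digit_sum_less[OF assms(1), of q]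
    by (simp add: n)
  ultimately show False
    using * n r by (cases q) auto
qed

text \<open>Below \<open>3 * p - 1\<close> the digit sum reaches \<open>p\<close> only at
  \<open>2 * p - 1\<close> and \<open>3 * p - 2\<close>, and both are odd for odd
  \<open>p\<close>.\<close>

lemma digit_sum_ge_imp_triple_le:
  assumes "odd p" "p > 2" "even n" "p \<le> digit_sum p n"
  shows "3 * p \<le> n + 1"
proof (rule ccontr)
  assume *: "\<not> 3 * p \<le> n + 1"
  define q r where "q = n div p" and "r = n mod p"
  have p2: "p \<ge> 2" using assms(2) by simp
  have r: "r < p" and n: "n = p * q + r"
    using p2 by (auto simp: q_def r_def)
  have "q < 3"
    using * assms(2) unfolding q_def by (simp add: div_less_iff_less_mult)
  \<comment> \<open>As \<open>q \<le> 2 < p\<close>, the quotient \<open>q\<close> is a single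
    digit.\<close>
  from this have s: "p \<le> q + r"
    using assms digit_sum_mult_add[OF p2 r, of q] digit_sum_less[OF p2, of q]
    by (simp add: n)
  have "q = 0 \<or> q = 1 \<and> Suc r = p \<or> q = 2 \<and> r + 2 = p"
    using * n r s \<open>q < 3\<close> by (auto simp: numeral_3_eq_3 less_Suc_eq)
  then consider "q = 0" | "q = 1" "Suc r = p" | "q = 2" "r + 2 = p"
    by blast
  thus False
  proof cases
    case 1
    thus False using s r by simp
  next
    case 2
    hence "Suc n = 2 * p" using n by simp
    thus False using assms(3) by (metis dvd_triv_left even_Suc)
  next
    case 3
    hence "n + 2 = 3 * p" using n by simp
    thus False using assms(1,3) by (metis even_add even_mult_iff even_numeral odd_numeral)
  qed
qed

subsection \<open>Denominators of Bernoulli polynomials\<close>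

text \<open>The index \<open>k = 0\<close> contributes nothing because
  \<open>bernoulli 0 = 1\<close>; \<open>k = n\<close> has binomial coefficient 1 and gives the
  first alternative; the indices in between give the digit sum condition.\<close>

lemma prime_dvd_poly_denom_bernpoly_iff_digit_sum:
  assumes "prime p" "odd p" "n > 0"
  shows "p dvd poly_denom (bernpoly n) \<longleftrightarrow> (p - 1) dvd n \<or> p \<le> digit_sum p n"
proof -
  have "p_integral p (bernoulli k) \<longleftrightarrow> \<not> (k > 0 \<and> (p - 1) dvd k)" for k
    using assms p_integral_bernoulli_iff[of p k]
    by (cases "k = 0") (simp_all add: bernoulli_0 p_integral_Ints)
  hence "p dvd poly_denom (bernpoly n) \<longleftrightarrow>
      (\<exists>k\<le>n. 0 < k \<and> (p - 1) dvd k \<and> \<not> p dvd (n choose k))"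
    using assms(1) by (auto simp: prime_dvd_poly_denom_bernpoly_iff)
  also have "\<dots> \<longleftrightarrow> (p - 1) dvd n \<or>
      (\<exists>k. 0 < k \<and> k < n \<and> (p - 1) dvd k \<and> \<not> p dvd (n choose k))"
  proof -
    have "\<not> p dvd (n choose n)"
      using assms(1) by auto
    thus ?thesis
      using assms(3) le_neq_implies_less[of _ n] less_imp_le[of _ n] by blast
  qed
  finally show ?thesis
    using ex_binomial_not_dvd_iff[OF assms(1), of n] by simp
qed

text \<open>The witness is \<open>k = n\<close> for even \<open>n\<close>, and \<open>k = 1\<close>
  for odd \<open>n\<close>, where \<open>n choose 1 = n\<close> is odd.\<close>

lemma even_poly_denom_bernpoly:
  assumes "n > 0"
  shows "even (poly_denom (bernpoly n))"
proof (cases "even n")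
  case True
  hence "\<not> p_integral 2 (bernoulli n)"
    using assms p_integral_bernoulli_iff[of 2 n] by simp
  thus ?thesis
    by (subst prime_dvd_poly_denom_bernpoly_iff) (auto intro!: exI[of _ n])
next
  case False
  thus ?thesis
    using assms not_2_integral_bernoulli_1
    by (subst prime_dvd_poly_denom_bernpoly_iff) (auto intro!: exI[of _ 1])
qed

lemma poly_denom_bernpoly_1: "poly_denom (bernpoly 1) = 2"
proof -
  have "p = 2" if "prime p" "p dvd poly_denom (bernpoly 1)" for p
  proof (rule ccontr)
    assume "p \<noteq> 2"
    hence "odd p" "p > 2" using prime_odd_nat[of p] prime_ge_2_nat[of p] that by auto
    thus False
      using prime_dvd_poly_denom_bernpoly_iff_digit_sum[of p 1] that digit_sum_less[of p 1] by simp
  qed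
  hence "{p. prime p \<and> p dvd poly_denom (bernpoly 1)} = {2}"
    using even_poly_denom_bernpoly[of 1] by auto
  thus ?thesis
    using squarefree_eq_prod_primes[OF squarefree_poly_denom_bernpoly, of 1] by simp
qed

lemma poly_denom_bernpoly_odd:
  assumes "n \<ge> 3" "odd n"
  shows "poly_denom (bernpoly n) =
    \<Prod>{p. prime p \<and> real p \<le> (real n + 1) / 2 \<and> digit_sum p n \<ge> p}"
proof -
  have "p dvd poly_denom (bernpoly n) \<longleftrightarrow> real p \<le> (real n + 1) / 2 \<and> p \<le> digit_sum p n"
    if "prime p" for p
  proof -
    have p2: "p \<ge> 2" using that by (rule prime_ge_2_nat)
    have "p dvd poly_denom (bernpoly n) \<longleftrightarrow> p \<le> digit_sum p n"
    proof (cases "p = 2")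
      case True
      \<comment> \<open>Both sides hold for \<open>p = 2\<close>: the last binary digit of
        \<open>n\<close> is 1, and \<open>n \<ge> 3\<close> leaves another nonzero digit.\<close>
      have "digit_sum 2 n = 1 + digit_sum 2 (n div 2)"
        using assms digit_sum_rec[of 2 n] by (simp add: odd_iff_mod_2_eq_one)
      moreover have "digit_sum 2 (n div 2) > 0"
        using assms by (intro digit_sum_pos) auto
      ultimately show ?thesis
        using True even_poly_denom_bernpoly[of n] assms by simp
    next
      case False
      hence "odd p" using that prime_odd_nat[of p] p2 by simp
      \<comment> \<open>An even number cannot divide the odd \<open>n\<close>, so only the digit sum
        condition remains.\<close>
      hence "even (p - 1)" by simp
      hence "\<not> (p - 1) dvd n"
        using assms(2) dvd_trans by blast
      thus ?thesis
        using prime_dvd_poly_denom_bernpoly_iff_digit_sum[of p n] \<open>odd p\<close> that assms by simp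
    qed
    moreover have "real p \<le> (real n + 1) / 2" if "p \<le> digit_sum p n"
      using digit_sum_ge_imp_double_le[OF p2 that] by (simp add: field_simps)
    ultimately show ?thesis by blast
  qed
  hence "{p. prime p \<and> p dvd poly_denom (bernpoly n)} =
      {p. prime p \<and> real p \<le> (real n + 1) / 2 \<and> digit_sum p n \<ge> p}"
    by blast
  thus ?thesis
    using squarefree_eq_prod_primes[OF squarefree_poly_denom_bernpoly, of n] by simp
qed

lemma poly_denom_bernpoly_even:
  assumes "n \<ge> 2" "even n"
  shows "poly_denom (bernpoly n) =
    \<Prod>{p. prime p \<and> (p - 1) dvd n} *
    \<Prod>{p. prime p \<and> \<not> (p - 1) dvd n \<and> real p \<le> (real n + 1) / 3 \<and> digit_sum p n \<ge> p}"
    (is "_ = \<Prod>?A * \<Prod>?B")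
proof -
  have "p dvd poly_denom (bernpoly n) \<longleftrightarrow>
      (p - 1) dvd n \<or> \<not> (p - 1) dvd n \<and> real p \<le> (real n + 1) / 3 \<and> p \<le> digit_sum p n"
    if "prime p" for p
  proof (cases "p = 2")
    case True
    thus ?thesis using even_poly_denom_bernpoly[of n] assms by simp
  next
    case False
    hence p: "odd p" "p > 2"
      using that prime_odd_nat[of p] prime_ge_2_nat[of p] by auto
    have "real p \<le> (real n + 1) / 3" if "p \<le> digit_sum p n"
      using digit_sum_ge_imp_triple_le[OF p assms(2) that] by (simp add: field_simps)
    thus ?thesis
      using prime_dvd_poly_denom_bernpoly_iff_digit_sum[of p n] p that assms by auto
  qed
  hence eq: "{p. prime p \<and> p dvd poly_denom (bernpoly n)} = ?A \<union> ?B"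
    by blast
  \<comment> \<open>Finiteness matters for splitting the product over the union, since a product
    over an infinite set is 1 by convention.\<close>
  have "finite {p. prime p \<and> p dvd poly_denom (bernpoly n)}"
    using finite_divisors_nat[OF poly_denom_pos[of "bernpoly n"]] by (rule rev_finite_subset) blast
  hence "finite ?A" "finite ?B"
    unfolding eq by auto
  hence "\<Prod>(?A \<union> ?B) = \<Prod>?A * \<Prod>?B"
    by (intro prod.union_disjoint) auto
  thus ?thesis
    using squarefree_eq_prod_primes[OF squarefree_poly_denom_bernpoly, of n] unfolding eq by simp
qed

lemma poly_denom_bernpoly_unbounded:
  "\<not> bdd_above ((\<lambda>n. poly_denom (bernpoly n)) ` {1..})"
proof
  assume "bdd_above ((\<lambda>n. poly_denom (bernpoly n)) ` {1..})"
  then obtain M where M: "poly_denom (bernpoly n) \<le> M" if "n \<ge> 1" for n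
    by (auto simp: bdd_above_def)
  obtain p where p: "prime p" "p > max M 2"
    using bigger_prime by blast
  hence "odd p" using prime_odd_nat[of p] by simp
  \<comment> \<open>At index \<open>p - 1\<close> the first alternative of the criterion holds
    trivially, so arbitrarily large primes occur as divisors.\<close>
  hence "p dvd poly_denom (bernpoly (p - 1))"
    using p by (subst prime_dvd_poly_denom_bernpoly_iff_digit_sum) auto
  hence "p \<le> poly_denom (bernpoly (p - 1))"
    using poly_denom_pos by (rule dvd_imp_le)
  also have "\<dots> \<le> M"
    using p by (intro M) auto
  finally show False using p by simp
qed

lemma rat_denom_bernoulli_dvd: "rat_denom (bernoulli n) dvd poly_denom (bernpoly n)"
proof (rule rat_denom_dvd)
  show "of_nat (poly_denom (bernpoly n)) * bernoulli n \<in> \<int>"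
    \<comment> \<open>\<open>bernoulli n\<close> is the constant coefficient of
      \<open>bernpoly n\<close>.\<close>
    using poly_denom_Ints[of "bernpoly n" 0] by (simp add: coeff_bernpoly)
qed

theorem theorem4:
  shows "poly_denom (bernpoly 1) = 2
    \<and> (\<forall>n\<ge>3. odd n \<longrightarrow>
          poly_denom (bernpoly n) =
            \<Prod>{p. prime p \<and> real p \<le> (real n + 1) / 2 \<and> digit_sum p n \<ge> p})
    \<and> (\<forall>n\<ge>2. even n \<longrightarrow>
          poly_denom (bernpoly n) =
            \<Prod>{p. prime p \<and> (p - 1) dvd n} *
            \<Prod>{p. prime p \<and> \<not> (p - 1) dvd n \<and> real p \<le> (real n + 1) / 3 \<and> digit_sum p n \<ge> p})
    \<and> (\<forall>n\<ge>1. even (poly_denom (bernpoly n)) \<and> squarefree (poly_denom (bernpoly n)))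
    \<and> \<not> bdd_above ((\<lambda>n. poly_denom (bernpoly n)) ` {1..})
    \<and> (\<forall>n\<ge>1. rat_denom (bernoulli n) dvd poly_denom (bernpoly n))"
  using poly_denom_bernpoly_1 poly_denom_bernpoly_odd poly_denom_bernpoly_even
    even_poly_denom_bernpoly squarefree_poly_denom_bernpoly poly_denom_bernpoly_unbounded
    rat_denom_bernoulli_dvd
  by (intro conjI allI impI) auto

end
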